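(* Let $a<b$ and $0<\alpha<1$. Let $p,g:[a,b]\to\mathbb{R}$ be continuous with $p(t)>0$ on $[a,b]$, and let $u\in H^1(a,b)$ satisfy $$({}^{ABC}{}_{a}D^\alpha u)(t)+p(t)u(t)=g(t)\qquad\text{for all } t\in(a,b].$$ Then $$\max_{t\in[a,b]}|u(t)|\ \le\ \max_{t\in[a,b]}\left|\frac{g(t)}{p(t)}\right|.$$
   Context: All functions are real-valued; a function in the Sobolev space $H^1(a,b)$ is identified with its continuous representative on $[a,b]$. $E_\alpha(z)=\sum_{k\ge 0} z^k/\Gamma(\alpha k+1)$ is the Mittag-Leffler function, and $B$ is a normalization function with $B(\alpha)>0$ and $B(0)=B(1)=1$. For $f\in H^1(a,b)$ and $\alpha\in(0,1)$, the left Caputo fractional derivative with Mittag-Leffler non-singular kernel is $$({}^{ABC}{}_{a}D^\alpha f)(t)=\frac{B(\alpha)}{1-\alpha}\int_a^t E_\alpha\!\left[-\frac{\alpha}{1-\alpha}(t-s)^\alpha\right] f'(s)\,ds,\qquad t\in[a,b].$$ *)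

theory Defs
  imports "HOL-Analysis.Analysis"
begin

text \<open>Functions on an interval are total functions \<open>real \<Rightarrow> real\<close>; no notion below depends on the
  values outside \<open>[a, b]\<close>.\<close>

definition L2_on :: "real \<Rightarrow> real \<Rightarrow> (real \<Rightarrow> real) set" where
  "L2_on a b = {f. set_borel_measurable lebesgue {a<..<b} f \<and>
                   set_integrable lebesgue {a<..<b} (\<lambda>x. (f x)\<^sup>2)}"

text \<open>The space \<open>C\<^sub>c\<^sup>\<infinity>(a, b)\<close>, each element extended by zero to the real line.\<close>

definition test_functions :: "real \<Rightarrow> real \<Rightarrow> (real \<Rightarrow> real) set" where
  "test_functions a b =
     {\<phi>. (\<forall>n x. (deriv ^^ n) \<phi> field_differentiable at x) \<and>
         compact (closure {x. \<phi> x \<noteq> 0}) \<and> closure {x. \<phi> x \<noteq> 0} \<subseteq> {a<..<b}}"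

definition has_weak_deriv :: "real \<Rightarrow> real \<Rightarrow> (real \<Rightarrow> real) \<Rightarrow> (real \<Rightarrow> real) \<Rightarrow> bool" where
  "has_weak_deriv a b f v \<longleftrightarrow>
     (\<forall>\<phi>\<in>test_functions a b.
        (LINT x:{a<..<b}|lebesgue. f x * deriv \<phi> x) = - (LINT x:{a<..<b}|lebesgue. v x * \<phi> x))"

text \<open>Elements of \<open>H\<^sup>1(a, b)\<close> are given by their continuous representative on \<open>[a, b]\<close>.\<close>

definition sobolev_H1 :: "real \<Rightarrow> real \<Rightarrow> (real \<Rightarrow> real) set" where
  "sobolev_H1 a b =
     {f. continuous_on {a..b} f \<and> f \<in> L2_on a b \<and> (\<exists>v\<in>L2_on a b. has_weak_deriv a b f v)}"

text \<open>The weak derivative is unique only up to null sets of \<open>(a, b)\<close>; a representative is chosen,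
  and it is used only under the integral.\<close>

definition weak_deriv :: "real \<Rightarrow> real \<Rightarrow> (real \<Rightarrow> real) \<Rightarrow> real \<Rightarrow> real" where
  "weak_deriv a b f = (SOME v. v \<in> L2_on a b \<and> has_weak_deriv a b f v)"

definition mittag_leffler :: "real \<Rightarrow> real \<Rightarrow> real" where
  "mittag_leffler \<alpha> z = (\<Sum>k. z ^ k / Gamma (\<alpha> * real k + 1))"

text \<open>The right endpoint \<open>b\<close> enters only through the interval on which the weak derivative is
  taken.\<close>

definition abc_deriv ::
  "(real \<Rightarrow> real) \<Rightarrow> real \<Rightarrow> real \<Rightarrow> real \<Rightarrow> (real \<Rightarrow> real) \<Rightarrow> real \<Rightarrow> real" where
  "abc_deriv B \<alpha> a b f t =
     B \<alpha> / (1 - \<alpha>) *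
     (LINT s:{a..t}|lebesgue.
        mittag_leffler \<alpha> (- (\<alpha> / (1 - \<alpha>)) * (t - s) powr \<alpha>) * weak_deriv a b f s)"

text \<open>The maximum of \<open>f\<close> over a possibly infinite set, where \<open>Max\<close> is not usable. Like \<open>THE\<close>, it is
  meaningful only if the maximum is attained, as it is for continuous \<open>f\<close> on compact nonempty
  \<open>S\<close>.\<close>

definition max_on :: "real set \<Rightarrow> (real \<Rightarrow> real) \<Rightarrow> real" where
  "max_on S f = (GREATEST y. y \<in> f ` S)"

lemma max_on_attained:
  assumes "compact S" "S \<noteq> {}" "continuous_on S f"
  shows "max_on S f \<in> f ` S" and "x \<in> S \<Longrightarrow> f x \<le> max_on S f"
proof -
  obtain m where m: "m \<in> S" "\<forall>y\<in>S. f y \<le> f m"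
    using continuous_attains_sup[OF assms] by blast
  then have "max_on S f = f m"
    unfolding max_on_def by (intro Greatest_equality) auto
  then show "max_on S f \<in> f ` S" and "x \<in> S \<Longrightarrow> f x \<le> max_on S f"
    using m by auto
qed

end

theory Submission imports Defs "HOL-Real_Asymp.Real_Asymp" begin

text \<open>Let \<open>k s = E\<^sub>\<alpha>(-\<lambda> (t - s)\<^sup>\<alpha>)\<close> be the kernel at time \<open>t\<close>. It increases on \<open>[a, t]\<close> with values in
  \<open>[0, 1]\<close> and \<open>k t = 1\<close>, so the second mean value theorem for integrals gives some \<open>c\<close> in \<open>[a, t]\<close> with
  \<open>\<integral>\<^sub>a\<^sup>t k u' = k(a) (u(c) - u(a)) + (u(t) - u(c)) = k(a) (u(t) - u(a)) + (1 - k(a)) (u(t) - u(c))\<close>.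
  Hence the fractional derivative is nonnegative at a maximum of \<open>u\<close> in \<open>(a, b]\<close>, and there
  \<open>p u \<le> g\<close>; if the maximum is at \<open>a\<close>, the same inequality follows by letting \<open>t\<close> decrease to \<open>a\<close>.
  The argument for \<open>-u\<close> gives the lower bound.

  The monotonicity and positivity of \<open>x \<mapsto> E\<^sub>\<alpha>(-x)\<close> come from the Gruenwald-Letnikov discretisation of
  the relaxation equation. With \<open>q = x / n\<^sup>\<alpha>\<close>, the coefficients of \<open>z\<^sup>n\<close> in
  \<open>(1 - z)\<^sup>\<alpha>\<^sup>-\<^sup>1 / ((1 - z)\<^sup>\<alpha> + q)\<close> and (suitably scaled) in \<open>1 / ((1 - z)\<^sup>\<alpha> + q)\<close> tend to \<open>E\<^sub>\<alpha>(-x)\<close> and to a positive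
  multiple of \<open>E\<^sub>\<alpha>'(-x)\<close>. These coefficients are nonnegative because all coefficients of \<open>(1 - z)\<^sup>\<alpha>\<close> but the
  first are nonpositive, and those of \<open>(1 - z)\<^sup>\<alpha>\<^sup>-\<^sup>1\<close> are nonnegative.\<close>

section \<open>The Mittag-Leffler function on the negative half-line\<close>

text \<open>The coefficient of \<open>z\<^sup>n\<close> in \<open>(1 - z)\<^sup>-\<^sup>s\<close>.\<close>

definition binom_coeff :: "real \<Rightarrow> nat \<Rightarrow> real" where
  "binom_coeff s n = pochhammer s n / fact n"

lemma binom_coeff_0 [simp]: "binom_coeff s 0 = 1"
  by (simp add: binom_coeff_def)

lemma pochhammer_nonneg_real: "(s::real) \<ge> 0 \<Longrightarrow> pochhammer s n \<ge> 0"
  unfolding pochhammer_prod by (intro prod_nonneg) auto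

lemma binom_coeff_nonneg: "s \<ge> 0 \<Longrightarrow> binom_coeff s n \<ge> 0"
  by (simp add: binom_coeff_def pochhammer_nonneg_real)

text \<open>Only the first factor of \<open>pochhammer s n\<close> can be negative. Used with s =
  -\<alpha>: this is the sign of the coefficients of (1 - z)^\<alpha> that drives the induction in
  \<open>discrete_derivative_nonneg\<close>.\<close>

lemma binom_coeff_nonpos:
  assumes "-1 \<le> s" "s \<le> 0" "n > 0"
  shows "binom_coeff s n \<le> 0"
proof -
  obtain m where "n = Suc m" using assms(3) by (cases n) auto
  moreover have "s * pochhammer (s + 1) m \<le> 0"
    using assms by (intro mult_nonpos_nonneg pochhammer_nonneg_real) auto
  ultimately show ?thesis
    by (simp add: binom_coeff_def pochhammer_rec divide_nonpos_pos)
qed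

text \<open>Vandermonde's identity: multiplying (1 - z)^(-s) by (1 - z)^(-t) adds the
  exponents.\<close>

lemma binom_coeff_convolution:
  "(\<Sum>i\<le>n. binom_coeff s i * binom_coeff t (n - i)) = binom_coeff (s + t) n"
proof -
  have "binom_coeff (s + t) n =
      (\<Sum>i\<le>n. real (n choose i) * pochhammer s i * pochhammer t (n - i) / fact n)"
    by (simp add: binom_coeff_def pochhammer_binomial_sum sum_divide_distrib)
  also have "\<dots> = (\<Sum>i\<le>n. binom_coeff s i * binom_coeff t (n - i))"
    by (intro sum.cong) (auto simp: binom_coeff_def binomial_fact)
  finally show ?thesis ..
qed

text \<open>Crude, but for fixed n it is polynomial in c, which is enough against a geometric
  factor.\<close>

lemma binom_coeff_le_power:
  assumes "0 \<le> s" "s \<le> c"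
  shows "binom_coeff s n \<le> (c + real n) ^ n"
proof -
  have "binom_coeff s n \<le> pochhammer s n"
    using assms pochhammer_nonneg_real[of s n] fact_ge_1[of n, where 'a=real]
    by (simp add: binom_coeff_def divide_le_eq mult_le_cancel_left1)
  also have "\<dots> = (\<Prod>i<n. s + real i)"
    by (simp add: pochhammer_prod lessThan_atLeast0)
  also have "\<dots> \<le> (\<Prod>i<n. c + real n)"
    using assms by (intro prod_mono) auto
  finally show ?thesis by simp
qed

lemma summable_poly_geometric:
  fixes c :: real
  shows "summable (\<lambda>k. (real k + c) ^ m * (1/4) ^ k)"
proof (rule summable_comparison_test_bigo)
  show "summable (\<lambda>k. norm ((1/2::real) ^ k))" by (simp add: summable_geometric)
  show "(\<lambda>k. (real k + c) ^ m * (1/4) ^ k) \<in> O(\<lambda>k. (1/2) ^ k)"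
    by real_asymp
qed

text \<open>The ratio of consecutive values is (1 + s/(n+1)) (n/(n+1))^s, at most exp(s/(n+1))
  exp(-s/(n+1)) = 1. So a single index N dominates all later n, which supplies the majorants for
  Tannery's theorem.\<close>

lemma binom_coeff_powr_antimono:
  assumes "s \<ge> 0" "0 < m" "m \<le> n"
  shows "binom_coeff (s + 1) n / real n powr s \<le> binom_coeff (s + 1) m / real m powr s"
  using assms(3)
proof (induction n rule: dec_induct)
  case (step n)
  have n: "n > 0" using step.hyps assms(2) by simp
  let ?x = "1 / real (Suc n)"
  have "(1 + s * ?x) * (real n / real (Suc n)) powr s \<le> exp (s * ?x) * exp (- ?x) powr s"
  proof (intro mult_mono powr_mono2)
    show "1 + s * ?x \<le> exp (s * ?x)" by (rule exp_ge_add_one_self)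
    show "real n / real (Suc n) \<le> exp (- ?x)"
      using exp_ge_add_one_self[of "- ?x"] by (simp add: field_simps)
  qed (use assms in auto)
  also have "\<dots> = 1" by (simp add: exp_powr_real mult_exp_exp)
  finally have 1: "(1 + s * ?x) * (real n / real (Suc n)) powr s \<le> 1" .
  have "binom_coeff (s + 1) (Suc n) / real (Suc n) powr s =
      (binom_coeff (s + 1) n / real n powr s) * ((1 + s * ?x) * (real n / real (Suc n)) powr s)"
  proof -
    have "binom_coeff (s + 1) (Suc n) = binom_coeff (s + 1) n * (1 + s * ?x)"
      unfolding binom_coeff_def pochhammer_rec' by (simp add: divide_simps)
    then show ?thesis
      using n by (simp add: powr_divide)
  qed
  also have "\<dots> \<le> (binom_coeff (s + 1) n / real n powr s) * 1"
    using 1 assms by (intro mult_left_mono) (auto intro!: divide_nonneg_nonneg binom_coeff_nonneg)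
  finally show ?case using step.IH by simp
qed simp

text \<open>Gauss's limit formula for 1 / Gamma, up to a factor tending to 1:
  \<open>rGamma_series\<close> has one more Pochhammer factor and one more power of n.\<close>

lemma binom_coeff_powr_tendsto:
  "(\<lambda>n. binom_coeff (s + 1) n / real n powr s) \<longlonglongrightarrow> 1 / Gamma (s + 1)"
proof -
  have "(\<lambda>n. rGamma_series (s + 1) n * (real n / (real n + s + 1))) \<longlonglongrightarrow> rGamma (s + 1) * 1"
    by (intro tendsto_mult rGamma_series_LIMSEQ) real_asymp
  moreover have "eventually (\<lambda>n. rGamma_series (s + 1) n * (real n / (real n + s + 1)) =
      binom_coeff (s + 1) n / real n powr s) sequentially"
  \<comment> \<open>The threshold makes n + s + 1 positive, so that this factor can be
    cancelled.\<close>
  proof (use eventually_gt_at_top[of "nat \<lceil>\<bar>s\<bar> + 1\<rceil>"] in eventually_elim)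
    case (elim n)
    then have n: "n > 0" "real n + s + 1 > 0" by linarith+
    have "rGamma_series (s + 1) n =
        (real n + s + 1) * pochhammer (s + 1) n / (fact n * (real n powr s * real n))"
      using n by (simp add: rGamma_series_def pochhammer_rec' powr_def distrib_right exp_add add_ac)
    then show ?case
      using n by (simp add: binom_coeff_def)
  qed
  ultimately have "(\<lambda>n. binom_coeff (s + 1) n / real n powr s) \<longlonglongrightarrow> rGamma (s + 1) * 1"
    by (rule Lim_transform_eventually)
  then show ?thesis
    by (simp add: rGamma_inverse_Gamma divide_inverse)
qed

section \<open>Signs of the discrete coefficients\<close>

lemma binom_coeff_series_bound:
  fixes s :: "nat \<Rightarrow> real"
  assumes "\<bar>q\<bar> \<le> 1/4" "\<And>k. 0 \<le> s k" "\<And>k. s k \<le> real k + 1"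
  shows "\<bar>q ^ k * binom_coeff (s k) n\<bar> \<le> (real k + (1 + real n)) ^ n * (1/4) ^ k"
proof -
  have "\<bar>q\<bar> ^ k * binom_coeff (s k) n \<le> (1/4) ^ k * (real k + 1 + real n) ^ n"
    using assms by (intro mult_mono power_mono binom_coeff_le_power binom_coeff_nonneg) auto
  then show ?thesis
    using assms(2) by (simp add: abs_mult power_abs binom_coeff_nonneg mult_ac add_ac)
qed

lemma summable_binom_coeff_series:
  fixes s :: "nat \<Rightarrow> real"
  assumes "\<bar>q\<bar> \<le> 1/4" "\<And>k. 0 \<le> s k" "\<And>k. s k \<le> real k + 1"
  shows "summable (\<lambda>k. q ^ k * binom_coeff (s k) n)"
  by (rule summable_comparison_test'[OF summable_poly_geometric[of "1 + real n" n]])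
     (use binom_coeff_series_bound[OF assms] in auto)

text \<open>Multiplying the generating function of the series by (1 - z)^(-t) adds t to every
  exponent. The sum over i is finite, so it may be exchanged with the series over k.\<close>

lemma binom_coeff_series_convolution:
  fixes s :: "nat \<Rightarrow> real"
  assumes "\<bar>q\<bar> \<le> 1/4" "\<And>k. 0 \<le> s k" "\<And>k. s k \<le> real k + 1"
  shows "(\<Sum>i\<le>n. binom_coeff t i * (\<Sum>k. q ^ k * binom_coeff (s k) (n - i))) =
         (\<Sum>k. q ^ k * binom_coeff (t + s k) n)"
proof -
  note summ = summable_binom_coeff_series[OF assms]
  have "(\<Sum>i\<le>n. binom_coeff t i * (\<Sum>k. q ^ k * binom_coeff (s k) (n - i))) =
      (\<Sum>i\<le>n. \<Sum>k. binom_coeff t i * (q ^ k * binom_coeff (s k) (n - i)))"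
    by (intro sum.cong refl suminf_mult[symmetric] summ)
  also have "\<dots> = (\<Sum>k. \<Sum>i\<le>n. binom_coeff t i * (q ^ k * binom_coeff (s k) (n - i)))"
    by (intro suminf_sum[symmetric] summable_mult summ)
  also have "\<dots> = (\<Sum>k. q ^ k * binom_coeff (t + s k) n)"
    by (simp add: binom_coeff_convolution[symmetric] sum_distrib_left mult_ac)
  finally show ?thesis .
qed

text \<open>The sum is the coefficient of \<open>z\<^sup>n\<close> in \<open>1 / ((1 - z)\<^sup>\<alpha> + q)\<close>; multiplying by the denominator gives the
  recurrence.\<close>

lemma discrete_derivative_nonneg:
  assumes "0 < \<alpha>" "\<alpha> \<le> 1" "0 \<le> q" "q \<le> 1/4"
  shows "0 \<le> (\<Sum>k. (- q) ^ k * binom_coeff (\<alpha> * (real k + 1)) n)"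
proof -
  define G where "G n = (\<Sum>k. (- q) ^ k * binom_coeff (\<alpha> * (real k + 1)) n)" for n
  have le: "\<alpha> * (real k + 1) \<le> real k + 1" "\<alpha> * real k \<le> real k + 1" for k
    using assms mult_left_le_one_le[of "real k + 1" \<alpha>] mult_left_le_one_le[of "real k" \<alpha>] by auto
  have nonneg: "0 \<le> \<alpha> * (real k + 1)" "0 \<le> \<alpha> * real k" for k
    using assms by auto
  have q: "\<bar>- q\<bar> \<le> 1/4"
    using assms by simp
  \<comment> \<open>Multiplying by (1 - z)^\<alpha> lowers every exponent \<alpha> (k + 1) to
    \<alpha> k. Splitting off k = 0 leaves the coefficient of the constant 1, which is
    \<open>binom_coeff 0 n\<close>, and -q times the original series.\<close>
  have recurrence: "(\<Sum>i\<le>n. binom_coeff (- \<alpha>) i * G (n - i)) = binom_coeff 0 n - q * G n" for n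
  proof -
    have "(\<Sum>i\<le>n. binom_coeff (- \<alpha>) i * G (n - i)) =
        (\<Sum>k. (- q) ^ k * binom_coeff (- \<alpha> + \<alpha> * (real k + 1)) n)"
      unfolding G_def by (rule binom_coeff_series_convolution[OF q nonneg(1) le(1)])
    also have "\<dots> = (\<Sum>k. (- q) ^ k * binom_coeff (\<alpha> * real k) n)"
      by (simp add: algebra_simps)
    also have "\<dots> = binom_coeff 0 n + (\<Sum>k. (- q) ^ Suc k * binom_coeff (\<alpha> * real (Suc k)) n)"
      using suminf_split_head[OF summable_binom_coeff_series[OF q nonneg(2) le(2), of n]] by simp
    also have "(\<Sum>k. (- q) ^ Suc k * binom_coeff (\<alpha> * real (Suc k)) n) =
        (\<Sum>k. (- q) * ((- q) ^ k * binom_coeff (\<alpha> * (real k + 1)) n))"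
      by (simp add: mult_ac add_ac)
    also have "\<dots> = - q * G n"
      unfolding G_def by (rule suminf_mult[OF summable_binom_coeff_series[OF q nonneg(1) le(1)]])
    finally show ?thesis by simp
  qed
  have "0 \<le> G n" for n
  proof (induction n rule: less_induct)
    case (less n)
    \<comment> \<open>By the recurrence, (1 + q) G n is \<open>binom_coeff 0 n\<close> minus this
      sum, whose terms pair a nonpositive coefficient with an earlier value of G.\<close>
    have "(\<Sum>i\<in>{..n} - {0}. binom_coeff (- \<alpha>) i * G (n - i)) \<le> 0"
      using assms less by (intro sum_nonpos mult_nonpos_nonneg binom_coeff_nonpos) auto
    moreover have "(\<Sum>i\<le>n. binom_coeff (- \<alpha>) i * G (n - i)) =
        G n + (\<Sum>i\<in>{..n} - {0}. binom_coeff (- \<alpha>) i * G (n - i))"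
      by (subst sum.remove[of _ 0]) auto
    moreover have "binom_coeff 0 n \<ge> 0" by (simp add: binom_coeff_nonneg)
    ultimately have "(1 + q) * G n \<ge> 0"
      using recurrence[of n] by (simp add: algebra_simps)
    then show ?case using assms by (simp add: zero_le_mult_iff)
  qed
  then show ?thesis by (simp add: G_def)
qed

text \<open>The sum is the coefficient of \<open>z\<^sup>n\<close> in \<open>(1 - z)\<^sup>\<alpha>\<^sup>-\<^sup>1 / ((1 - z)\<^sup>\<alpha> + q)\<close>.\<close>

lemma discrete_relaxation_nonneg:
  assumes "0 < \<alpha>" "\<alpha> \<le> 1" "0 \<le> q" "q \<le> 1/4"
  shows "0 \<le> (\<Sum>k. (- q) ^ k * binom_coeff (\<alpha> * real k + 1) n)"
proof -
  \<comment> \<open>Since \<alpha> k + 1 = (1 - \<alpha>) + \<alpha> (k + 1), this is the previous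
    series convolved with the nonnegative coefficients of (1 - z)^(\<alpha> - 1).\<close>
  have "(\<Sum>k. (- q) ^ k * binom_coeff (\<alpha> * real k + 1) n) =
      (\<Sum>i\<le>n. binom_coeff (1 - \<alpha>) i * (\<Sum>k. (- q) ^ k * binom_coeff (\<alpha> * (real k + 1)) (n - i)))"
    by (subst binom_coeff_series_convolution)
       (use assms in \<open>auto simp: algebra_simps mult_left_le_one_le add_mono\<close>)
  also have "\<dots> \<ge> 0"
    by (intro sum_nonneg mult_nonneg_nonneg binom_coeff_nonneg discrete_derivative_nonneg)
       (use assms in auto)
  finally show ?thesis .
qed

section \<open>Passage from the discretisation to the limit\<close>

lemma exists_powr_scale:
  assumes "0 < \<alpha>"
  obtains N :: nat where "N > 0" "\<And>n. n \<ge> N \<Longrightarrow> \<bar>x\<bar> / real n powr \<alpha> \<le> 1/4"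
proof -
  have "(\<lambda>n. \<bar>x\<bar> / real n powr \<alpha>) \<longlonglongrightarrow> 0"
    using assms by real_asymp
  then have "eventually (\<lambda>n. \<bar>x\<bar> / real n powr \<alpha> < 1/4) sequentially"
    by (rule order_tendstoD) simp
  then obtain N where N: "\<And>n. n \<ge> N \<Longrightarrow> \<bar>x\<bar> / real n powr \<alpha> < 1/4"
    by (auto simp: eventually_sequentially)
  show thesis
  proof (rule that[of "Suc N"])
    show "\<bar>x\<bar> / real n powr \<alpha> \<le> 1/4" if "n \<ge> Suc N" for n
      using N[of n] that by linarith
  qed simp
qed

lemma power_scale:
  "n > 0 \<Longrightarrow> (x / real n powr \<alpha>) ^ k = x ^ k / real n powr (\<alpha> * real k)"
  by (simp add: power_divide powr_powr[symmetric] powr_realpow)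

text \<open>Tannery's theorem: the k-th term tends to x^k / Gamma(\<alpha> k + 1) and is dominated
  for n \<ge> N by its value at N with |x| in place of x. These majorants are summable because |x| /
  N^\<alpha> \<le> 1/4. Absolute convergence of the Mittag-Leffler series is a by-product.\<close>

lemma discrete_relaxation_tendsto:
  assumes "0 < \<alpha>" "\<alpha> \<le> 1"
  shows "summable (\<lambda>k. \<bar>x ^ k / Gamma (\<alpha> * real k + 1)\<bar>)"
    and "(\<lambda>n. \<Sum>k. (x / real n powr \<alpha>) ^ k * binom_coeff (\<alpha> * real k + 1) n)
      \<longlonglongrightarrow> mittag_leffler \<alpha> x"
proof -
  obtain N :: nat where N: "N > 0" "\<bar>x\<bar> / real N powr \<alpha> \<le> 1/4"
    using exists_powr_scale[OF assms(1)] by blast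
  let ?a = "\<lambda>k n. x ^ k * (binom_coeff (\<alpha> * real k + 1) n / real n powr (\<alpha> * real k))"
  let ?M = "\<lambda>k. \<bar>x\<bar> ^ k * (binom_coeff (\<alpha> * real k + 1) N / real N powr (\<alpha> * real k))"
  have "summable (\<lambda>k. (\<bar>x\<bar> / real N powr \<alpha>) ^ k * binom_coeff (\<alpha> * real k + 1) N)"
    using N assms by (intro summable_binom_coeff_series) (auto simp: mult_left_le_one_le)
  then have summ: "summable ?M"
    using N by (simp add: power_scale)
  have lim: "(\<lambda>n. ?a k n) \<longlonglongrightarrow> x ^ k * (1 / Gamma (\<alpha> * real k + 1))" for k
    by (intro tendsto_intros binom_coeff_powr_tendsto)
  have "norm (?a k n) \<le> ?M k" if "n \<ge> N" for k n
  proof -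
    have "\<bar>x\<bar> ^ k * (binom_coeff (\<alpha> * real k + 1) n / real n powr (\<alpha> * real k)) \<le> ?M k"
      using assms N that by (intro mult_left_mono binom_coeff_powr_antimono) auto
    then show ?thesis
      using assms by (simp add: abs_mult power_abs binom_coeff_nonneg)
  qed
  then have bound: "eventually (\<lambda>(k, n). norm (?a k n) \<le> ?M k) (at_top \<times>\<^sub>F sequentially)"
    by (subst eventually_prod_filter)
       (auto intro!: exI[of _ "\<lambda>_. True"] exI[of _ "\<lambda>n. N \<le> n"] eventually_ge_at_top)
  note tan = tannerys_theorem[OF lim bound summ sequentially_bot]
  show "summable (\<lambda>k. \<bar>x ^ k / Gamma (\<alpha> * real k + 1)\<bar>)"
    using tan by simp
  have "(\<lambda>n. \<Sum>k. ?a k n) \<longlonglongrightarrow> mittag_leffler \<alpha> x"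
    using tan by (simp add: mittag_leffler_def)
  moreover have "eventually (\<lambda>n. (\<Sum>k. ?a k n) =
      (\<Sum>k. (x / real n powr \<alpha>) ^ k * binom_coeff (\<alpha> * real k + 1) n)) sequentially"
    using eventually_gt_at_top[of 0] by eventually_elim (simp add: power_scale)
  ultimately show "(\<lambda>n. \<Sum>k. (x / real n powr \<alpha>) ^ k * binom_coeff (\<alpha> * real k + 1) n)
      \<longlonglongrightarrow> mittag_leffler \<alpha> x"
    by (simp add: tendsto_cong)
qed

text \<open>Both sides are pochhammer s (n + 1) / n!. Lowering the parameter puts the majorants of
  \<open>discrete_derivative_tendsto\<close> within the growth condition of
  \<open>summable_binom_coeff_series\<close>.\<close>

lemma binom_coeff_Suc_shift: "s * binom_coeff (s + 1) n = (real n + 1) * binom_coeff s (Suc n)"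
proof -
  have "binom_coeff s (Suc n) = (s * pochhammer (s + 1) n) / ((real n + 1) * fact n)"
    by (simp only: binom_coeff_def pochhammer_rec fact_Suc of_nat_Suc of_nat_mult of_nat_fact add.commute)
  then show ?thesis by (simp add: binom_coeff_def)
qed

text \<open>\<open>binom_coeff_powr_antimono\<close> cannot be applied with exponent s - 1 when s <
  1, as for s = \<alpha> < 1. Raising the parameter to s + 1 makes the exponent nonnegative.\<close>

lemma binom_coeff_le_shift:
  assumes "s \<ge> 0"
  shows "real n * binom_coeff s n \<le> s * binom_coeff (s + 1) n"
proof -
  have "s * pochhammer (s + 1) n = (s + real n) * pochhammer s n"
    by (simp only: pochhammer_rec[symmetric] pochhammer_rec')
  then have "s * binom_coeff (s + 1) n = (s + real n) * binom_coeff s n"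
    by (simp add: binom_coeff_def)
  then show ?thesis
    using assms binom_coeff_nonneg[OF assms, of n] by (simp add: distrib_right)
qed

text \<open>The k-th term of the series behaves like x^k n^(\<alpha> - 1) / Gamma(\<alpha> (k + 1)),
  hence the scaling by n^(1 - \<alpha>). The limit is the two-parameter Mittag-Leffler function with
  both parameters \<alpha>.\<close>

lemma discrete_derivative_tendsto:
  assumes "0 < \<alpha>" "\<alpha> \<le> 1"
  shows "(\<lambda>n. real n / real n powr \<alpha> *
      (\<Sum>k. (x / real n powr \<alpha>) ^ k * binom_coeff (\<alpha> * (real k + 1)) n))
      \<longlonglongrightarrow> (\<Sum>k. x ^ k / Gamma (\<alpha> * (real k + 1)))"
proof -
  obtain N :: nat where N: "N > 0" "\<And>n. n \<ge> N \<Longrightarrow> \<bar>x\<bar> / real n powr \<alpha> \<le> 1/4"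
    using exists_powr_scale[OF assms(1)] by blast
  let ?s = "\<lambda>k. \<alpha> * (real k + 1)"
  let ?a = "\<lambda>k n. x ^ k * (real n * binom_coeff (?s k) n / real n powr ?s k)"
  \<comment> \<open>The bound from \<open>binom_coeff_le_shift\<close> at n = N, rewritten by
    \<open>binom_coeff_Suc_shift\<close>; hence \<open>Suc N\<close> beside powers of N.\<close>
  let ?M = "\<lambda>k. \<bar>x\<bar> ^ k * ((real N + 1) * binom_coeff (?s k) (Suc N) / real N powr ?s k)"
  have s: "0 \<le> ?s k" "?s k \<le> real k + 1" for k
    using assms mult_left_le_one_le[of "real k + 1" \<alpha>] by auto
  have powr_s: "real n powr ?s k = real n powr \<alpha> * real n powr (\<alpha> * real k)" for n k
    by (simp add: distrib_left powr_add mult.commute)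
  have "summable (\<lambda>k. (\<bar>x\<bar> / real N powr \<alpha>) ^ k * binom_coeff (?s k) (Suc N))"
    using N by (intro summable_binom_coeff_series s) auto
  then have "summable (\<lambda>k. (real N + 1) / real N powr \<alpha> *
      ((\<bar>x\<bar> / real N powr \<alpha>) ^ k * binom_coeff (?s k) (Suc N)))"
    by (rule summable_mult)
  then have summ: "summable ?M"
    using N by (simp add: power_scale powr_s mult_ac)
  have lim: "(\<lambda>n. ?a k n) \<longlonglongrightarrow> x ^ k * (1 / Gamma (?s k))" for k
  proof -
    have "(\<lambda>n. binom_coeff (?s k) n / real n powr (?s k - 1)) \<longlonglongrightarrow> 1 / Gamma (?s k)"
      using binom_coeff_powr_tendsto[of "?s k - 1"] by simp
    moreover have "eventually (\<lambda>n. binom_coeff (?s k) n / real n powr (?s k - 1) =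
        real n * binom_coeff (?s k) n / real n powr ?s k) sequentially"
      using eventually_gt_at_top[of 0] by eventually_elim (simp add: powr_diff)
    ultimately have "(\<lambda>n. real n * binom_coeff (?s k) n / real n powr ?s k) \<longlonglongrightarrow> 1 / Gamma (?s k)"
      by (simp add: tendsto_cong)
    then show ?thesis by (intro tendsto_mult tendsto_const)
  qed
  have "norm (?a k n) \<le> ?M k" if "n \<ge> N" for k n
  proof -
    have "real n * binom_coeff (?s k) n / real n powr ?s k \<le>
        ?s k * (binom_coeff (?s k + 1) n / real n powr ?s k)"
      using binom_coeff_le_shift[OF s(1)] by (simp add: divide_right_mono)
    also have "\<dots> \<le> ?s k * (binom_coeff (?s k + 1) N / real N powr ?s k)"
      by (intro mult_left_mono binom_coeff_powr_antimono N s that)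
    also have "\<dots> = (real N + 1) * binom_coeff (?s k) (Suc N) / real N powr ?s k"
      by (simp add: binom_coeff_Suc_shift[symmetric])
    finally have "\<bar>x\<bar> ^ k * (real n * binom_coeff (?s k) n / real n powr ?s k) \<le> ?M k"
      by (intro mult_left_mono) auto
    then show ?thesis
      using s[of k] by (simp add: abs_mult power_abs binom_coeff_nonneg)
  qed
  then have bound: "eventually (\<lambda>(k, n). norm (?a k n) \<le> ?M k) (at_top \<times>\<^sub>F sequentially)"
    by (subst eventually_prod_filter)
       (auto intro!: exI[of _ "\<lambda>_. True"] exI[of _ "\<lambda>n. N \<le> n"] eventually_ge_at_top)
  have "(\<lambda>n. \<Sum>k. ?a k n) \<longlonglongrightarrow> (\<Sum>k. x ^ k / Gamma (?s k))"
    using tannerys_theorem[OF lim bound summ sequentially_bot] by simp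
  moreover have "eventually (\<lambda>n. (\<Sum>k. ?a k n) = real n / real n powr \<alpha> *
      (\<Sum>k. (x / real n powr \<alpha>) ^ k * binom_coeff (?s k) n)) sequentially"
    using eventually_ge_at_top[of N]
  proof eventually_elim
    case (elim n)
    have "(\<Sum>k. ?a k n) =
        (\<Sum>k. real n / real n powr \<alpha> * ((x / real n powr \<alpha>) ^ k * binom_coeff (?s k) n))"
      using N elim by (simp add: power_scale powr_s mult_ac)
    also have "\<dots> = real n / real n powr \<alpha> * (\<Sum>k. (x / real n powr \<alpha>) ^ k * binom_coeff (?s k) n)"
      using N(2)[OF elim] by (intro suminf_mult summable_binom_coeff_series s) auto
    finally show ?case .
  qed
  ultimately show ?thesis
    by (simp add: tendsto_cong)
qed

section \<open>Sign and monotonicity of the Mittag-Leffler function\<close>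

lemma mittag_leffler_nonneg:
  assumes "0 < \<alpha>" "\<alpha> \<le> 1" "x \<le> 0"
  shows "0 \<le> mittag_leffler \<alpha> x"
proof (rule tendsto_lowerbound[OF discrete_relaxation_tendsto(2)[OF assms(1,2)]])
  obtain N :: nat where N: "N > 0" "\<And>n. n \<ge> N \<Longrightarrow> \<bar>x\<bar> / real n powr \<alpha> \<le> 1/4"
    using exists_powr_scale[OF assms(1)] by blast
  show "eventually (\<lambda>n. 0 \<le> (\<Sum>k. (x / real n powr \<alpha>) ^ k * binom_coeff (\<alpha> * real k + 1) n)) sequentially"
    using eventually_ge_at_top[of N]
  proof eventually_elim
    case (elim n)
    have x: "x / real n powr \<alpha> = - (\<bar>x\<bar> / real n powr \<alpha>)"
      using assms by simp
    show ?case
      unfolding x by (rule discrete_relaxation_nonneg[OF assms(1,2) _ N(2)[OF elim]]) simp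
  qed
qed simp

text \<open>Termwise differentiation: by Gamma(s + 1) = s Gamma(s) at s = \<alpha> (k + 1), the
  factor k + 1 cancels and 1 / \<alpha> remains.\<close>

lemma mittag_leffler_derivative:
  assumes "0 < \<alpha>" "\<alpha> \<le> 1"
  shows "(mittag_leffler \<alpha> has_real_derivative (\<Sum>k. x ^ k / Gamma (\<alpha> * (real k + 1))) / \<alpha>) (at x)"
proof -
  let ?c = "\<lambda>k. 1 / Gamma (\<alpha> * real k + 1)"
  have "summable (\<lambda>k. ?c k * y ^ k)" for y
    using discrete_relaxation_tendsto(1)[OF assms, of y]
    by (intro summable_norm_cancel[of "\<lambda>k. ?c k * y ^ k"]) simp
  then have "((\<lambda>x. \<Sum>k. ?c k * x ^ k) has_field_derivative (\<Sum>k. diffs ?c k * x ^ k)) (at x)"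
    by (rule termdiffs_strong_converges_everywhere)
  moreover have "(\<lambda>x. \<Sum>k. ?c k * x ^ k) = mittag_leffler \<alpha>"
    by (simp add: mittag_leffler_def fun_eq_iff)
  moreover have "(\<Sum>k. diffs ?c k * x ^ k) = (\<Sum>k. x ^ k / Gamma (\<alpha> * (real k + 1))) / \<alpha>"
  proof -
    have c: "diffs ?c k * x ^ k = x ^ k / Gamma (\<alpha> * (real k + 1)) * (1 / \<alpha>)" for k
    proof -
      have "\<alpha> * (real k + 1) > 0"
        using assms by simp
      then have "Gamma (\<alpha> * (real k + 1) + 1) = \<alpha> * (real k + 1) * Gamma (\<alpha> * (real k + 1))"
        using nonpos_Ints_nonpos not_le by (intro Gamma_plus1) blast
      then show ?thesis
        by (simp add: diffs_def add_ac)
    qed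
    have "summable (\<lambda>k. diffs ?c k * x ^ k)"
      by (rule termdiff_converges_all) fact
    then have "summable (\<lambda>k. diffs ?c k * x ^ k * \<alpha>)"
      by (rule summable_mult2)
    then have "summable (\<lambda>k. x ^ k / Gamma (\<alpha> * (real k + 1)))"
      using assms unfolding c by simp
    from suminf_mult2[OF this, of "1 / \<alpha>"] show ?thesis
      by (simp add: c)
  qed
  ultimately show ?thesis by simp
qed

lemma mittag_leffler_mono:
  assumes "0 < \<alpha>" "\<alpha> \<le> 1" "x \<le> y" "y \<le> 0"
  shows "mittag_leffler \<alpha> x \<le> mittag_leffler \<alpha> y"
proof (rule DERIV_nonneg_imp_nondecreasing[OF assms(3)])
  fix z assume z: "x \<le> z" "z \<le> y"
  obtain N :: nat where N: "N > 0" "\<And>n. n \<ge> N \<Longrightarrow> \<bar>z\<bar> / real n powr \<alpha> \<le> 1/4"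
    using exists_powr_scale[OF assms(1)] by blast
  have "0 \<le> (\<Sum>k. z ^ k / Gamma (\<alpha> * (real k + 1)))"
  proof (rule tendsto_lowerbound[OF discrete_derivative_tendsto[OF assms(1,2)]])
    show "eventually (\<lambda>n. 0 \<le> real n / real n powr \<alpha> *
        (\<Sum>k. (z / real n powr \<alpha>) ^ k * binom_coeff (\<alpha> * (real k + 1)) n)) sequentially"
      using eventually_ge_at_top[of N]
    proof eventually_elim
      case (elim n)
      have z': "z / real n powr \<alpha> = - (\<bar>z\<bar> / real n powr \<alpha>)"
        using z assms by simp
      show ?case
        unfolding z' by (intro mult_nonneg_nonneg discrete_derivative_nonneg[OF assms(1,2) _ N(2)[OF elim]]) auto
    qed
  qed simp
  then show "\<exists>d. (mittag_leffler \<alpha> has_real_derivative d) (at z) \<and> 0 \<le> d"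
    using mittag_leffler_derivative[OF assms(1,2)] assms(1) by fastforce
qed

lemma mittag_leffler_0 [simp]: "mittag_leffler \<alpha> 0 = 1"
proof -
  have "mittag_leffler \<alpha> 0 = (\<Sum>k. (1 / Gamma (\<alpha> * real k + 1)) * 0 ^ k)"
    by (simp add: mittag_leffler_def)
  also have "\<dots> = 1"
    by (subst powser_zero) simp
  finally show ?thesis .
qed

section \<open>Smooth test functions\<close>

text \<open>The differentiability clause of \<open>test_functions\<close>, separated from the
  support condition.\<close>

definition smooth :: "(real \<Rightarrow> real) \<Rightarrow> bool" where
  "smooth f \<longleftrightarrow> (\<forall>n x. (deriv ^^ n) f field_differentiable at x)"

lemma smooth_differentiable: "smooth f \<Longrightarrow> f field_differentiable at x"
  unfolding smooth_def by (drule spec[of _ 0]) simp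

lemma smooth_deriv: "smooth f \<Longrightarrow> smooth (deriv f)"
  unfolding smooth_def by (metis comp_apply funpow_Suc_right)

lemma smooth_has_derivative: "smooth f \<Longrightarrow> (f has_real_derivative deriv f x) (at x)"
  by (simp add: DERIV_deriv_iff_field_differentiable smooth_differentiable)

text \<open>All iterated derivatives stay in S. Each use picks a shape of functions that
  differentiation preserves, which avoids formulas for the n-th derivative.\<close>

lemma smooth_coinduct:
  assumes "f \<in> S" "\<And>g. g \<in> S \<Longrightarrow> \<exists>g'\<in>S. \<forall>x. (g has_real_derivative g' x) (at x)"
  shows "smooth f"
proof -
  have closed: "deriv g \<in> S" if g: "g \<in> S" for g
  proof -
    obtain g' where "g' \<in> S" "\<And>x. (g has_real_derivative g' x) (at x)"
      using assms(2) g by blast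
    moreover from this have "deriv g = g'"
      using DERIV_imp_deriv by blast
    ultimately show ?thesis by simp
  qed
  have "(deriv ^^ n) f \<in> S" for n
    by (induction n) (auto simp: assms(1) closed)
  then show ?thesis
    unfolding smooth_def field_differentiable_def using assms(2) by blast
qed

lemma smooth_primitive:
  assumes "smooth g" "\<And>x. (f has_real_derivative g x) (at x)"
  shows "smooth f"
  by (rule smooth_coinduct[of _ "insert f {h. smooth h}"])
     (use assms smooth_deriv smooth_has_derivative in blast)+

lemma smooth_combination:
  assumes "smooth f" "smooth g"
  shows "smooth (\<lambda>x. c * f (k * x + m) + d * g (k * x + l))"
proof (rule smooth_coinduct)
  \<comment> \<open>k, m and l stay fixed: the chain rule only rescales c and d by k and replaces f
    and g by their derivatives.\<close>
  let ?S = "{\<lambda>x. c * f (k * x + m) + d * g (k * x + l) | c d f g. smooth f \<and> smooth g}"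
  show "(\<lambda>x. c * f (k * x + m) + d * g (k * x + l)) \<in> ?S"
    using assms by blast
  show "\<exists>h'\<in>?S. \<forall>x. (h has_real_derivative h' x) (at x)" if h_in: "h \<in> ?S" for h
  proof -
    obtain c d f g where h: "h = (\<lambda>x. c * f (k * x + m) + d * g (k * x + l))" "smooth f" "smooth g"
      using h_in by blast
    have f': "((\<lambda>x. f (k * x + m)) has_real_derivative deriv f (k * x + m) * k) (at x)" for x
      by (rule DERIV_chain2[OF smooth_has_derivative[OF h(2)]]) (auto intro!: derivative_eq_intros)
    have g': "((\<lambda>x. g (k * x + l)) has_real_derivative deriv g (k * x + l) * k) (at x)" for x
      by (rule DERIV_chain2[OF smooth_has_derivative[OF h(3)]]) (auto intro!: derivative_eq_intros)
    define h' where "h' = (\<lambda>x. (c * k) * deriv f (k * x + m) + (d * k) * deriv g (k * x + l))"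
    have h'_deriv: "(h has_real_derivative h' x) (at x)" for x
      unfolding h(1) h'_def using DERIV_add[OF DERIV_cmult[OF f'[of x], of c] DERIV_cmult[OF g'[of x], of d]]
      by (simp add: mult_ac)
    have h'_in: "h' \<in> ?S"
      unfolding h'_def using h(2,3) smooth_deriv by blast
    show ?thesis
      using h'_deriv by (intro bexI[OF _ h'_in] allI)
  qed
qed

lemma smooth_mult:
  assumes "smooth f" "smooth g"
  shows "smooth (\<lambda>x. f x * g x)"
proof -
  let ?T = "{(f, g). smooth f \<and> smooth g}"
  \<comment> \<open>The product rule turns one product into two, so the shape is a finite sum of
    products, encoded by a list of pairs.\<close>
  let ?S = "{\<lambda>x. \<Sum>(f, g)\<leftarrow>ps. f x * g x | ps. set ps \<subseteq> ?T}"
  show ?thesis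
  proof (rule smooth_coinduct[of _ ?S])
    show "(\<lambda>x. f x * g x) \<in> ?S"
      using assms by (intro CollectI exI[of _ "[(f, g)]"]) simp
    show "\<exists>h'\<in>?S. \<forall>x. (h has_real_derivative h' x) (at x)" if h_in: "h \<in> ?S" for h
    proof -
      obtain ps where ps: "h = (\<lambda>x. \<Sum>(f, g)\<leftarrow>ps. f x * g x)" "set ps \<subseteq> ?T"
        using h_in by blast
      define qs where "qs = concat (map (\<lambda>(f, g). [(deriv f, g), (f, deriv g)]) ps)"
      have "set qs \<subseteq> ?T"
        using ps(2) smooth_deriv unfolding qs_def by fastforce
      moreover have "((\<lambda>x. \<Sum>(f, g)\<leftarrow>ps. f x * g x) has_real_derivative
          (\<Sum>(f, g)\<leftarrow>qs. f x * g x)) (at x)" for x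
        using ps(2) unfolding qs_def
      proof (induction ps)
        case (Cons p ps)
        obtain f g where p: "p = (f, g)" "smooth f" "smooth g"
          using Cons.prems by auto
        have "((\<lambda>x. f x * g x) has_real_derivative deriv f x * g x + f x * deriv g x) (at x)"
          using smooth_has_derivative[OF p(2)] smooth_has_derivative[OF p(3)]
          by (auto intro!: derivative_eq_intros)
        from DERIV_add[OF this Cons.IH] show ?case
          using Cons.prems by (simp add: p(1) add_ac)
      qed simp
      ultimately show ?thesis
        unfolding ps(1) by (intro bexI[of _ "\<lambda>x. \<Sum>(f, g)\<leftarrow>qs. f x * g x"]) auto
    qed
  qed
qed

lemma smooth_exp_inverse: "smooth (\<lambda>x. if x > 0 then exp (- 1 / x) else 0)"
proof (rule smooth_coinduct)
  let ?h = "\<lambda>p x. if x > 0 then poly p (1 / x) * exp (- 1 / x) else (0::real)"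
  let ?S = "{?h p | p. True}"
  show "(\<lambda>x. if x > 0 then exp (- 1 / x) else 0) \<in> ?S"
    by (intro CollectI exI[of _ 1]) (auto simp: fun_eq_iff)
  show "\<exists>f'\<in>?S. \<forall>x. (f has_real_derivative f' x) (at x)" if f_in: "f \<in> ?S" for f
  proof -
    obtain p where f: "f = ?h p" using f_in by blast
    \<comment> \<open>With y = 1 / x, the x-derivative of p(y) exp(-y) is y^2 (p(y) - p'(y))
      exp(-y).\<close>
    define q :: "real poly" where "q = [:0, 0, 1:] * (p - pderiv p)"
    have "(?h p has_real_derivative ?h q x) (at x)" for x
    proof -
      consider "x > 0" | "x < 0" | "x = 0" by linarith
      then show ?thesis
      proof cases
        case 1
        have "((\<lambda>x. poly p (1 / x) * exp (- 1 / x)) has_real_derivative ?h q x) (at x)"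
          using 1 by (auto intro!: derivative_eq_intros
              simp: q_def power2_eq_square algebra_simps divide_simps)
        then show ?thesis
          by (rule has_field_derivative_transform_within_open[of _ _ _ "{0<..}"]) (use 1 in auto)
      next
        case 2
        have "((\<lambda>x. 0) has_real_derivative 0) (at x)" by simp
        then have "(?h p has_real_derivative 0) (at x)"
          by (rule has_field_derivative_transform_within_open[of _ _ _ "{..<0}"]) (use 2 in auto)
        then show ?thesis using 2 by simp
      next
        case 3
        have lim: "((\<lambda>y. poly r y * exp (- y)) \<longlongrightarrow> 0) at_top" for r :: "real poly"
        proof -
          have "((\<lambda>y. \<Sum>i\<le>degree r. coeff r i * (y ^ i / exp y)) \<longlongrightarrow> (\<Sum>i\<le>degree r. coeff r i * 0)) at_top"
            by (intro tendsto_sum tendsto_mult tendsto_const tendsto_power_div_exp_0)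
          then show ?thesis
            by (simp add: poly_altdef sum_distrib_right exp_minus divide_inverse mult.assoc)
        qed
        \<comment> \<open>Dividing by the increment in the difference quotient at 0 multiplies the
          polynomial in the inverse by its variable, hence \<open>[:0, 1:]\<close>.\<close>
        have "((\<lambda>y. poly ([:0, 1:] * p) (inverse y) * exp (- inverse y)) \<longlongrightarrow> 0) (at_right 0)"
          by (rule filterlim_compose[OF lim filterlim_inverse_at_top_right])
        moreover have "eventually (\<lambda>y. poly ([:0, 1:] * p) (inverse y) * exp (- inverse y) = ?h p y / y) (at_right 0)"
          using eventually_at_right_less[of "0::real"] by eventually_elim (simp add: divide_simps)
        ultimately have "((\<lambda>y. ?h p y / y) \<longlongrightarrow> 0) (at_right 0)"
          by (simp add: tendsto_cong)
        moreover have "((\<lambda>y. ?h p y / y) \<longlongrightarrow> 0) (at_left 0)"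
          by (rule tendsto_eventually) (auto simp: eventually_at_left_field intro!: exI[of _ "- 1"])
        ultimately have "((\<lambda>y. ?h p y / y) \<longlongrightarrow> 0) (at 0)"
          by (rule filterlim_split_at_real[rotated])
        then show ?thesis using 3 by (simp add: has_field_derivative_iff)
      qed
    qed
    then show ?thesis
      unfolding f by (intro bexI[of _ "?h q"]) blast+
  qed
qed

text \<open>\<Psi> is the primitive of the bump e(x) e(1 - x), normalised to rise from 0 to 1; the
  normalising constant is positive because the bump is positive inside (0, 1).\<close>

lemma exists_smooth_step:
  obtains \<psi> \<Psi> :: "real \<Rightarrow> real" where
    "\<And>x. (\<Psi> has_real_derivative \<psi> x) (at x)" "smooth \<Psi>"
    "\<And>x. 0 \<le> \<psi> x" "\<And>x. x \<notin> {0<..<1} \<Longrightarrow> \<psi> x = 0"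
    "\<And>x. 0 \<le> \<Psi> x" "\<And>x. \<Psi> x \<le> 1" "\<And>x. x \<le> 0 \<Longrightarrow> \<Psi> x = 0" "\<And>x. x \<ge> 1 \<Longrightarrow> \<Psi> x = 1"
proof -
  define e where "e x = (if x > 0 then exp (- 1 / x) else (0::real))" for x
  define f where "f x = e x * e (1 - x)" for x
  have "smooth e"
    using smooth_exp_inverse unfolding e_def .
  then have f: "smooth f"
    unfolding f_def using smooth_mult smooth_combination[of e e 1 "-1" 1 0 0] by simp
  have nonneg: "0 \<le> f x" and zero: "x \<notin> {0<..<1} \<Longrightarrow> f x = 0" for x
    by (auto simp: f_def e_def)
  have cont: "continuous_on S f" for S
    using DERIV_continuous_on smooth_has_derivative[OF f] has_field_derivative_at_within by blast
  have "\<exists>F. \<forall>x :: real. -\<infinity> < ereal x \<longrightarrow> ereal x < \<infinity> \<longrightarrow> (F has_vector_derivative f x) (at x)"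
    using cont[of UNIV] by (intro einterval_antiderivative) (auto simp: continuous_on_eq_continuous_at)
  then obtain F where F: "\<And>x. (F has_real_derivative f x) (at x)"
    by (auto simp: has_real_derivative_iff_has_vector_derivative)
  have mono: "F x \<le> F y" if "x \<le> y" for x y
    by (rule DERIV_nonneg_imp_nondecreasing[OF that]) (use F nonneg in blast)
  have F0: "F x = F 0" if "x \<le> 0" for x
    using MVT2[of x 0 F f] F zero that by fastforce
  have F1: "F x = F 1" if "x \<ge> 1" for x
    using MVT2[of 1 x F f] F zero that by fastforce
  have pos: "F 0 < F 1"
  proof -
    obtain z where "0 < z" "z < 1" "F 1 - F 0 = f z"
      using MVT2[of 0 1 F f] F by auto
    moreover from this have "f z > 0"
      by (simp add: f_def e_def)
    ultimately show ?thesis by simp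
  qed
  show thesis
  proof
    let ?d = "F 1 - F 0"
    show D: "((\<lambda>x. (F x - F 0) / ?d) has_real_derivative f x / ?d) (at x)" for x
      using F pos by (auto intro!: derivative_eq_intros)
    have "smooth (\<lambda>x. f x / ?d)"
      using smooth_combination[OF f f, of "1 / ?d" 1 0 0 0] by simp
    then show "smooth (\<lambda>x. (F x - F 0) / ?d)"
      using D by (rule smooth_primitive)
    show "0 \<le> f x / ?d" "x \<notin> {0<..<1} \<Longrightarrow> f x / ?d = 0" for x
      using nonneg zero pos by auto
    show "x \<le> 0 \<Longrightarrow> (F x - F 0) / ?d = 0" "x \<ge> 1 \<Longrightarrow> (F x - F 0) / ?d = 1" for x
      using F0[of x] F1[of x] pos by auto
    show "0 \<le> (F x - F 0) / ?d" for x
      using mono[of 0 x] F0[of x] pos by (cases "x \<le> 0") auto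
    show "(F x - F 0) / ?d \<le> 1" for x
      using mono[of x 1] F1[of x] pos by (cases "x \<ge> 1") auto
  qed
qed

section \<open>Integration of weak derivatives\<close>

text \<open>The factor beside u is a nonnegative weight of mass 1, the increment of \<Psi>, and
  vanishes outside [e, e + h]. So the integral averages values of u within \<epsilon> of y.\<close>

lemma smooth_step_mollifies:
  assumes \<Psi>: "\<And>x. (\<Psi> has_real_derivative \<psi> x) (at x)" "\<And>x. x \<le> 0 \<Longrightarrow> \<Psi> x = 0" "\<And>x. x \<ge> 1 \<Longrightarrow> \<Psi> x = 1"
    and \<psi>: "continuous_on UNIV \<psi>" "\<And>x. 0 \<le> \<psi> x" "\<And>x. x \<notin> {0<..<1} \<Longrightarrow> \<psi> x = 0"
    and u: "continuous_on {a..b} u" and h: "0 < h" "a \<le> e" "e + h \<le> b"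
    and close: "\<And>x. x \<in> {e..e + h} \<Longrightarrow> \<bar>u x - y\<bar> \<le> \<epsilon>"
  shows "\<bar>integral {a..b} (\<lambda>x. u x * (\<psi> (1 / h * x + - e / h) * (1 / h))) - y\<bar> \<le> \<epsilon>"
proof -
  define w where "w x = \<psi> (1 / h * x + - e / h) * (1 / h)" for x
  have "((\<lambda>x. \<Psi> (1 / h * x + - e / h)) has_real_derivative w x) (at x within {a..b})" for x
    unfolding w_def by (rule has_field_derivative_at_within, rule DERIV_chain2[OF \<Psi>(1)])
      (use h in \<open>auto intro!: derivative_eq_intros\<close>)
  then have "(w has_integral (\<Psi> (1 / h * b + - e / h) - \<Psi> (1 / h * a + - e / h))) {a..b}"
    using h by (intro fundamental_theorem_of_calculus)
      (auto simp: has_real_derivative_iff_has_vector_derivative)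
  moreover have "\<Psi> (1 / h * b + - e / h) = 1" "\<Psi> (1 / h * a + - e / h) = 0"
    using h by (auto intro!: \<Psi> simp: field_simps)
  ultimately have w: "(w has_integral 1) {a..b}" by simp
  have cont_w: "continuous_on {a..b} w"
    unfolding w_def by (intro continuous_intros continuous_on_compose2[OF \<psi>(1)]) auto
  have uw: "(\<lambda>x. u x * w x) integrable_on {a..b}"
    by (intro integrable_continuous_interval continuous_intros u cont_w)
  have yw: "((\<lambda>x. y * w x) has_integral y * 1) {a..b}"
    by (rule has_integral_mult_right[OF w])
  have "integral {a..b} (\<lambda>x. u x * w x) - y = integral {a..b} (\<lambda>x. u x * w x - y * w x)"
    using integral_unique[OF yw] by (subst integral_diff[OF uw has_integral_integrable[OF yw]]) simp
  also have "\<bar>\<dots>\<bar> \<le> integral {a..b} (\<lambda>x. \<epsilon> * w x)"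
  proof (subst real_norm_def[symmetric], rule Henstock_Kurzweil_Integration.integral_norm_bound_integral)
    show "(\<lambda>x. u x * w x - y * w x) integrable_on {a..b}"
      using uw yw by (intro integrable_diff) (auto simp: integrable_on_def)
    show "(\<lambda>x. \<epsilon> * w x) integrable_on {a..b}"
      using w by (intro integrable_on_mult_right) (auto simp: integrable_on_def)
    show "norm (u x * w x - y * w x) \<le> \<epsilon> * w x" for x
    proof (cases "x \<in> {e..e + h}")
      case True
      have "w x \<ge> 0" using \<psi>(2) h by (simp add: w_def)
      then have "\<bar>u x - y\<bar> * w x \<le> \<epsilon> * w x"
        using close[OF True] by (intro mult_right_mono)
      then show ?thesis
        using \<open>w x \<ge> 0\<close> by (simp add: left_diff_distrib[symmetric] abs_mult)
    next
      case False
      then have "1 / h * x + - e / h \<notin> {0<..<1}"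
        using h by (auto simp: field_simps)
      then show ?thesis using \<psi>(3) by (simp add: w_def)
    qed
  qed
  also have "\<dots> = \<epsilon>"
    using integral_unique[OF has_integral_mult_right[OF w, of \<epsilon>]] by simp
  finally show ?thesis by (simp add: w_def)
qed

text \<open>A smooth substitute for the indicator function of [c, d], whose distributional
  derivative is the point mass at c minus that at d; the last clause is a quantitative form of this
  for the given u.\<close>

definition plateau_function ::
  "real \<Rightarrow> real \<Rightarrow> real \<Rightarrow> real \<Rightarrow> real \<Rightarrow> (real \<Rightarrow> real) \<Rightarrow> (real \<Rightarrow> real) \<Rightarrow> bool" where
  "plateau_function a b c d h u \<phi> \<longleftrightarrow>
     \<phi> \<in> test_functions a b \<and> continuous_on {a..b} \<phi> \<and> continuous_on {a..b} (deriv \<phi>) \<and>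
     (\<forall>x. 0 \<le> \<phi> x) \<and> (\<forall>x. \<phi> x \<le> 1) \<and>
     (\<forall>x\<in>{c..d}. \<phi> x = 1) \<and> (\<forall>x. x \<notin> {c - h..d + h} \<longrightarrow> \<phi> x = 0) \<and>
     (\<forall>\<epsilon>. (\<forall>x\<in>{c - h..c}. \<bar>u x - u c\<bar> \<le> \<epsilon>) \<longrightarrow> (\<forall>x\<in>{d..d + h}. \<bar>u x - u d\<bar> \<le> \<epsilon>) \<longrightarrow>
        \<bar>integral {a..b} (\<lambda>x. u x * deriv \<phi> x) - (u c - u d)\<bar> \<le> 2 * \<epsilon>)"

lemma exists_plateau_function:
  fixes a b c d h :: real and u :: "real \<Rightarrow> real"
  assumes "c \<le> d" "0 < h" "a < c - h" "d + h < b"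
    and u: "continuous_on {a..b} u"
  shows "\<exists>\<phi>. plateau_function a b c d h u \<phi>"
proof -
  obtain \<psi> \<Psi> :: "real \<Rightarrow> real" where
    step: "\<And>x. (\<Psi> has_real_derivative \<psi> x) (at x)" "smooth \<Psi>"
    "\<And>x. 0 \<le> \<psi> x" "\<And>x. x \<notin> {0<..<1} \<Longrightarrow> \<psi> x = 0"
    "\<And>x. 0 \<le> \<Psi> x" "\<And>x. \<Psi> x \<le> 1" "\<And>x. x \<le> 0 \<Longrightarrow> \<Psi> x = 0" "\<And>x. x \<ge> 1 \<Longrightarrow> \<Psi> x = 1"
    by (rule exists_smooth_step) blast
  have smooth_continuous: "continuous_on A f" if f: "smooth f" for A f
    by (rule DERIV_continuous_on[OF has_field_derivative_at_within[OF smooth_has_derivative[OF f]]])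
  have "deriv \<Psi> = \<psi>"
    using step(1) DERIV_imp_deriv by blast
  then have cont_\<psi>: "continuous_on A \<psi>" for A
    using smooth_continuous smooth_deriv step(2) by metis
  \<comment> \<open>The first step rises on [c - h, c], the subtracted one on [d, d + h]. Both
    intervals lie inside (a, b), which gives the support condition.\<close>
  define \<phi> where "\<phi> x = 1 * \<Psi> (1 / h * x + - (c - h) / h) + (- 1) * \<Psi> (1 / h * x + - d / h)" for x
  have smooth: "smooth \<phi>"
    unfolding \<phi>_def by (rule smooth_combination) (fact step)+
  have D: "((\<lambda>x. \<Psi> (1 / h * x + m)) has_real_derivative \<psi> (1 / h * x + m) * (1 / h)) (at x)" for m x
    by (rule DERIV_chain2[OF step(1)]) (use assms in \<open>auto intro!: derivative_eq_intros\<close>)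
  have deriv: "deriv \<phi> x = \<psi> (1 / h * x + - (c - h) / h) * (1 / h) - \<psi> (1 / h * x + - d / h) * (1 / h)" for x
    unfolding \<phi>_def using DERIV_diff[OF D[of "- (c - h) / h" x] D[of "- d / h" x]] by (intro DERIV_imp_deriv) simp
  have one: "\<phi> x = 1" if "x \<in> {c..d}" for x
  proof -
    have "1 / h * x + - (c - h) / h \<ge> 1" "1 / h * x + - d / h \<le> 0"
      using that assms by (auto simp: field_simps)
    then show ?thesis using step by (simp add: \<phi>_def)
  qed
  have left: "\<phi> x = 0" if "x \<le> c - h" for x
  proof -
    have "1 / h * x + - (c - h) / h \<le> 0" "1 / h * x + - d / h \<le> 0"
      using that assms by (auto simp: field_simps)
    then show ?thesis using step by (simp add: \<phi>_def)
  qed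
  have right: "\<phi> x = 0" if "x \<ge> d + h" for x
  proof -
    have "1 / h * x + - (c - h) / h \<ge> 1" "1 / h * x + - d / h \<ge> 1"
      using that assms by (auto simp: field_simps)
    then show ?thesis using step by (simp add: \<phi>_def)
  qed
  have zero: "\<phi> x = 0" if "x \<notin> {c - h..d + h}" for x
    using that left[of x] right[of x] by force
  have range: "0 \<le> \<phi> x" "\<phi> x \<le> 1" for x
  proof -
    have "0 \<le> \<phi> x \<and> \<phi> x \<le> 1"
    \<comment> \<open>Up to d the second step is still 0; beyond d the first is already 1. So the
      value is that of one step or 1 minus it.\<close>
    proof (cases "x \<le> d")
      case True
      then have "1 / h * x + - d / h \<le> 0"
        using assms by (auto simp: field_simps)
      then show ?thesis using step by (simp add: \<phi>_def)
    next
      case False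
      then have "1 / h * x + - (c - h) / h \<ge> 1"
        using assms by (auto simp: field_simps)
      then show ?thesis using step by (simp add: \<phi>_def)
    qed
    then show "0 \<le> \<phi> x" "\<phi> x \<le> 1" by auto
  qed
  have "closure {x. \<phi> x \<noteq> 0} \<subseteq> {c - h..d + h}"
    using zero by (intro closure_minimal subsetI) (blast, simp)
  moreover from this have "compact (closure {x. \<phi> x \<noteq> 0})"
    by (simp add: compact_eq_bounded_closed bounded_subset[OF bounded_closed_interval])
  ultimately have \<phi>: "\<phi> \<in> test_functions a b"
    using smooth assms unfolding test_functions_def smooth_def by auto
  have bound: "\<bar>integral {a..b} (\<lambda>x. u x * deriv \<phi> x) - (u c - u d)\<bar> \<le> 2 * \<epsilon>"
    if c: "\<forall>x\<in>{c - h..c}. \<bar>u x - u c\<bar> \<le> \<epsilon>" and d: "\<forall>x\<in>{d..d + h}. \<bar>u x - u d\<bar> \<le> \<epsilon>" for \<epsilon>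
  proof -
    let ?f = "\<lambda>e x. u x * (\<psi> (1 / h * x + - e / h) * (1 / h))"
    have "\<bar>integral {a..b} (?f (c - h)) - u c\<bar> \<le> \<epsilon>"
      using step cont_\<psi> u assms c by (intro smooth_step_mollifies[of \<Psi>]) auto
    moreover have "\<bar>integral {a..b} (?f d) - u d\<bar> \<le> \<epsilon>"
      using step cont_\<psi> u assms d by (intro smooth_step_mollifies[of \<Psi>]) auto
    moreover have "integral {a..b} (\<lambda>x. u x * deriv \<phi> x) = integral {a..b} (?f (c - h)) - integral {a..b} (?f d)"
    proof -
      have int: "?f e integrable_on {a..b}" for e
        by (intro integrable_continuous_interval continuous_intros u continuous_on_compose2[OF cont_\<psi>[of UNIV]]) auto
      from integral_diff[OF int[of "c - h"] int[of d]] show ?thesis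
        by (simp add: deriv right_diff_distrib)
    qed
    ultimately show ?thesis by linarith
  qed
  have "plateau_function a b c d h u \<phi>"
    unfolding plateau_function_def
    by (intro conjI allI ballI impI)
       (simp_all add: \<phi> smooth_continuous smooth smooth_deriv range one zero bound)
  then show ?thesis by (rule exI[of _ \<phi>])
qed

text \<open>On a bounded interval square-integrability implies integrability, by |y| \<le> 1 +
  y^2.\<close>

lemma L2_on_absolutely_integrable:
  assumes "v \<in> L2_on a b"
  shows "v absolutely_integrable_on {a..b}"
proof -
  let ?S = "{a<..<b}"
  have m: "set_borel_measurable lebesgue ?S v" and sq: "set_integrable lebesgue ?S (\<lambda>x. (v x)\<^sup>2)"
    using assms by (auto simp: L2_on_def)
  have "(\<lambda>_. 1 :: real) absolutely_integrable_on {a..b}"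
    by (intro absolutely_integrable_continuous_real continuous_intros)
  then have "set_integrable lebesgue ?S (\<lambda>x. 1 + (v x)\<^sup>2)"
    using sq by (intro set_integral_add) (simp_all add: absolutely_integrable_on_Icc_iff_Ioo)
  then have "set_integrable lebesgue ?S v"
    unfolding set_integrable_def
  proof (rule Bochner_Integration.integrable_bound)
    show "(\<lambda>x. indicator ?S x *\<^sub>R v x) \<in> borel_measurable lebesgue"
      using m by (simp add: set_borel_measurable_def)
    have "\<bar>y\<bar> \<le> 1 + y\<^sup>2" for y :: real
      using sum_squares_bound[of 1 "\<bar>y\<bar>"] by simp
    then show "AE x in lebesgue. norm (indicator ?S x *\<^sub>R v x) \<le> norm (indicator ?S x *\<^sub>R (1 + (v x)\<^sup>2))"
      by (auto simp: indicator_def intro!: AE_I2)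
  qed
  then show ?thesis by (simp add: absolutely_integrable_on_Icc_iff_Ioo)
qed

lemma absolutely_integrable_continuous_mult:
  fixes g v :: "real \<Rightarrow> real"
  assumes "continuous_on {a..b} g" "v absolutely_integrable_on {a..b}"
  shows "(\<lambda>x. g x * v x) absolutely_integrable_on {a..b}"
  using assms
  by (intro absolutely_integrable_bounded_measurable_product_real
        continuous_imp_measurable_on_sets_lebesgue compact_imp_bounded compact_continuous_image) auto

lemma set_lebesgue_integral_open_interval:
  fixes f :: "real \<Rightarrow> real"
  assumes "f absolutely_integrable_on {a..b}"
  shows "(LINT x:{a<..<b}|lebesgue. f x) = integral {a..b} f"
  using assms set_lebesgue_integral_eq_integral(2)[of "{a<..<b}" f]
  by (simp add: absolutely_integrable_on_Icc_iff_Ioo integral_open_interval_real)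

text \<open>The weak derivative is tested with plateau functions of shrinking width: one side tends
  to u(c) - u(d) by continuity of u, the other to minus the integral of v over [c, d] by dominated
  convergence.\<close>

lemma weak_deriv_integral_interior:
  assumes u: "continuous_on {a..b} u" and v: "v absolutely_integrable_on {a..b}"
    and weak: "has_weak_deriv a b u v" and cd: "a < c" "c \<le> d" "d < b"
  shows "integral {c..d} v = u d - u c"
proof -
  \<comment> \<open>Dividing by n + 2 keeps the width strictly below both distances already at n =
    0.\<close>
  define h where "h n = min (c - a) (b - d) / (real n + 2)" for n :: nat
  have h: "0 < h n" "a < c - h n" "d + h n < b" for n
  proof -
    have "0 < h n" "h n < min (c - a) (b - d)"
      using cd by (auto simp: h_def divide_less_eq mult_less_cancel_left1 simp del: min_less_iff_conj)
    then show "0 < h n" "a < c - h n" "d + h n < b" by auto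
  qed
  have h_lim: "h \<longlonglongrightarrow> 0"
    unfolding h_def by real_asymp
  obtain \<phi> where plateau: "\<And>n. plateau_function a b c d (h n) u (\<phi> n)"
    using exists_plateau_function[OF cd(2) h u] by metis
  have \<phi>: "\<phi> n \<in> test_functions a b" "continuous_on {a..b} (\<phi> n)" "continuous_on {a..b} (deriv (\<phi> n))"
    "0 \<le> \<phi> n x" "\<phi> n x \<le> 1"
    "x \<in> {c..d} \<Longrightarrow> \<phi> n x = 1" "x \<notin> {c - h n..d + h n} \<Longrightarrow> \<phi> n x = 0"
    "\<forall>x\<in>{c - h n..c}. \<bar>u x - u c\<bar> \<le> \<epsilon> \<Longrightarrow> \<forall>x\<in>{d..d + h n}. \<bar>u x - u d\<bar> \<le> \<epsilon> \<Longrightarrow>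
       \<bar>integral {a..b} (\<lambda>x. u x * deriv (\<phi> n) x) - (u c - u d)\<bar> \<le> 2 * \<epsilon>" for n x \<epsilon>
    using plateau[of n] unfolding plateau_function_def by blast+
  have parts: "integral {a..b} (\<lambda>x. u x * deriv (\<phi> n) x) = - integral {a..b} (\<lambda>x. v x * \<phi> n x)" for n
  proof -
    have "(\<lambda>x. u x * deriv (\<phi> n) x) absolutely_integrable_on {a..b}"
      using u \<phi>(3)[of n] by (intro absolutely_integrable_continuous_real continuous_intros)
    moreover have "(\<lambda>x. v x * \<phi> n x) absolutely_integrable_on {a..b}"
      using absolutely_integrable_continuous_mult[OF \<phi>(2) v] by (simp add: mult.commute)
    moreover have "(LINT x:{a<..<b}|lebesgue. u x * deriv (\<phi> n) x) = - (LINT x:{a<..<b}|lebesgue. v x * \<phi> n x)"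
      using weak \<phi>(1) by (simp add: has_weak_deriv_def)
    ultimately show ?thesis
      by (simp add: set_lebesgue_integral_open_interval)
  qed
  have "(\<lambda>n. integral {a..b} (\<lambda>x. u x * deriv (\<phi> n) x)) \<longlonglongrightarrow> u c - u d"
  proof (rule LIMSEQ_I)
    fix r :: real assume r: "0 < r"
    have "isCont u c" "isCont u d"
      using u cd by (auto intro!: continuous_on_interior[OF u])
    then obtain s s' where s: "s > 0" "s' > 0" "\<And>x. \<bar>x - c\<bar> < s \<Longrightarrow> \<bar>u x - u c\<bar> < r / 4"
        "\<And>x. \<bar>x - d\<bar> < s' \<Longrightarrow> \<bar>u x - u d\<bar> < r / 4"
      using r unfolding continuous_at_eps_delta dist_real_def by (metis divide_pos_pos zero_less_numeral)
    obtain N where N: "\<And>n. n \<ge> N \<Longrightarrow> h n < min s s'"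
      using order_tendstoD(2)[OF h_lim, of "min s s'"] s by (auto simp: eventually_sequentially)
    have "norm (integral {a..b} (\<lambda>x. u x * deriv (\<phi> n) x) - (u c - u d)) < r" if "n \<ge> N" for n
    proof -
      have "\<forall>x\<in>{c - h n..c}. \<bar>u x - u c\<bar> \<le> r / 4"
        using N[OF that] by (intro ballI less_imp_le[OF s(3)]) auto
      moreover have "\<forall>x\<in>{d..d + h n}. \<bar>u x - u d\<bar> \<le> r / 4"
        using N[OF that] by (intro ballI less_imp_le[OF s(4)]) auto
      ultimately
      have "\<bar>integral {a..b} (\<lambda>x. u x * deriv (\<phi> n) x) - (u c - u d)\<bar> \<le> 2 * (r / 4)"
        by (rule \<phi>(8))
      then show ?thesis using r by simp
    qed
    then show "\<exists>no. \<forall>n\<ge>no. norm (integral {a..b} (\<lambda>x. u x * deriv (\<phi> n) x) - (u c - u d)) < r"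
      by blast
  qed
  moreover have "(\<lambda>n. integral {a..b} (\<lambda>x. v x * \<phi> n x)) \<longlonglongrightarrow> integral {a..b} (\<lambda>x. if x \<in> {c..d} then v x else 0)"
  proof (rule dominated_convergence(2))
    show "(\<lambda>x. v x * \<phi> n x) integrable_on {a..b}" for n
      using absolutely_integrable_continuous_mult[OF \<phi>(2) v]
      by (simp add: mult.commute absolutely_integrable_on_def)
    show "(\<lambda>x. \<bar>v x\<bar>) integrable_on {a..b}"
      using v by (simp add: absolutely_integrable_on_def)
    show "norm (v x * \<phi> n x) \<le> \<bar>v x\<bar>" for n x
      using \<phi>(4,5)[of n x] by (simp add: abs_mult mult_left_le)
    show "(\<lambda>n. v x * \<phi> n x) \<longlonglongrightarrow> (if x \<in> {c..d} then v x else 0)" for x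
    proof (cases "x \<in> {c..d}")
      case False
      \<comment> \<open>For x outside [c, d] this maximum is the distance from x to [c, d].\<close>
      have "eventually (\<lambda>n. h n < max (c - x) (x - d)) sequentially"
        using False by (intro order_tendstoD(2)[OF h_lim]) auto
      then have "eventually (\<lambda>n. v x * \<phi> n x = 0) sequentially"
      proof eventually_elim
        case (elim n)
        then have "x \<notin> {c - h n..d + h n}"
          by (auto simp: less_max_iff_disj)
        then show ?case by (simp add: \<phi>(7))
      qed
      from tendsto_eventually[OF this] show ?thesis
        using False by auto
    qed (simp add: \<phi>(6))
  qed
  ultimately have "u c - u d = - integral {a..b} (\<lambda>x. if x \<in> {c..d} then v x else 0)"
    unfolding parts by (metis LIMSEQ_unique tendsto_minus)
  moreover have "{c..d} \<inter> {a..b} = {c..d}"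
    using cd by auto
  ultimately have "u c - u d = - integral {c..d} v"
    by (simp only: integral_restrict_Int)
  then show ?thesis by simp
qed

text \<open>Reaches the endpoints: u minus the indefinite integral of v is constant on (a, b) by the
  interior case, hence on [a, b] by continuity.\<close>

lemma weak_deriv_integral:
  assumes "a < b" and u: "continuous_on {a..b} u" and v: "v absolutely_integrable_on {a..b}"
    and weak: "has_weak_deriv a b u v" and cd: "a \<le> c" "c \<le> d" "d \<le> b"
  shows "integral {c..d} v = u d - u c"
proof -
  define f where "f x = u x - integral {a..x} v" for x
  have int: "v integrable_on {x..y}" if "a \<le> x" "y \<le> b" for x y
    using absolutely_integrable_on_subinterval[OF v, of x y] that by (auto simp: absolutely_integrable_on_def)
  have cont: "continuous_on {a..b} f"
    unfolding f_def by (intro continuous_intros u indefinite_integral_continuous_1 int) auto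
  have combine: "integral {x..y} v = integral {a..y} v - integral {a..x} v" if "a \<le> x" "x \<le> y" "y \<le> b" for x y
    using Henstock_Kurzweil_Integration.integral_combine[OF that(1,2) int[of a y]] that by simp
  let ?m = "(a + b) / 2"
  have "f x = f ?m" if "x \<in> {a<..<b}" for x
  proof (cases "x \<le> ?m")
    case True
    then show ?thesis
      using weak_deriv_integral_interior[OF u v weak, of x ?m] combine[of x ?m] that by (simp add: f_def)
  next
    case False
    then show ?thesis
      using weak_deriv_integral_interior[OF u v weak, of ?m x] combine[of ?m x] that by (simp add: f_def)
  qed
  note interior = this
  have "f x = f ?m" if "x \<in> {a..b}" for x
  proof (rule continuous_constant_on_closure[of "{a<..<b}" f "f ?m" x])
    show "continuous_on (closure {a<..<b}) f" "x \<in> closure {a<..<b}"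
      using cont that \<open>a < b\<close> by simp_all
  qed (rule interior)
  from this[of c] this[of d] show ?thesis
    using combine[OF cd] cd by (simp add: f_def)
qed

section \<open>The maximum principle\<close>

text \<open>Only values of u at a, c and t remain, so points of maximum can be exploited although
  the weak derivative has no pointwise meaning.\<close>

lemma abc_deriv_second_mean_value:
  assumes "0 < \<alpha>" "\<alpha> < 1" "a < b" and u: "u \<in> sobolev_H1 a b" and t: "a < t" "t \<le> b"
  obtains c where "c \<in> {a..t}"
    "abc_deriv B \<alpha> a b u t = B \<alpha> / (1 - \<alpha>) *
       (mittag_leffler \<alpha> (- (\<alpha> / (1 - \<alpha>)) * (t - a) powr \<alpha>) * (u c - u a) + (u t - u c))"
proof -
  define v where "v = weak_deriv a b u"
  define k where "k s = mittag_leffler \<alpha> (- (\<alpha> / (1 - \<alpha>)) * (t - s) powr \<alpha>)" for s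
  have cont: "continuous_on {a..b} u" and "\<exists>v. v \<in> L2_on a b \<and> has_weak_deriv a b u v"
    using u by (auto simp: sobolev_H1_def)
  \<comment> \<open>Whichever representative \<open>weak_deriv\<close> chooses, only these two
    properties of it are used.\<close>
  from someI_ex[OF this(2)] have v: "v absolutely_integrable_on {a..b}" "has_weak_deriv a b u v"
    by (auto simp: v_def weak_deriv_def L2_on_absolutely_integrable)
  have v_t: "v absolutely_integrable_on {a..t}"
    using absolutely_integrable_on_subinterval[OF v(1), of a t] t by auto
  note integral_v = weak_deriv_integral[OF \<open>a < b\<close> cont v]
  have ml_cont: "continuous_on UNIV (mittag_leffler \<alpha>)"
    using mittag_leffler_derivative[of \<alpha>] assms
    by (intro DERIV_continuous_on) (auto intro: has_field_derivative_at_within)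
  have "continuous_on {a..t} (\<lambda>s. - (\<alpha> / (1 - \<alpha>)) * (t - s) powr \<alpha>)"
    using assms by (intro continuous_intros continuous_on_powr') auto
  then have "continuous_on {a..t} k"
    unfolding k_def by (rule continuous_on_compose2[OF ml_cont]) auto
  then have kv: "(\<lambda>s. k s * v s) absolutely_integrable_on {a..t}"
    using v_t by (rule absolutely_integrable_continuous_mult)
  have mono: "k x \<le> k y" if "a \<le> x" "x \<le> y" "y \<le> t" for x y
    unfolding k_def using that assms
    by (intro mittag_leffler_mono mult_left_mono_neg powr_mono2 mult_nonpos_nonneg) auto
  have "v integrable_on {a..t}"
    using v_t by (simp add: absolutely_integrable_on_def)
  then obtain c where c: "c \<in> {a..t}"
    "((\<lambda>s. k s * v s) has_integral (k a * integral {a..c} v + k t * integral {c..t} v)) {a..t}"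
    using second_mean_value_theorem_full[of v a t k] mono t by auto
  have "abc_deriv B \<alpha> a b u t = B \<alpha> / (1 - \<alpha>) * integral {a..t} (\<lambda>s. k s * v s)"
    using set_lebesgue_integral_eq_integral(2)[OF kv] by (simp add: abc_deriv_def v_def k_def)
  \<comment> \<open>At s = t the argument of the kernel is 0, so k t = 1.\<close>
  also have "integral {a..t} (\<lambda>s. k s * v s) = k a * (u c - u a) + (u t - u c)"
    using integral_unique[OF c(2)] integral_v[of a c] integral_v[of c t] c(1) t
    by (simp add: k_def)
  finally show thesis
    using that[OF c(1)] by (simp add: k_def)
qed

text \<open>Stated for the mean value relation instead of \<open>abc_deriv\<close>, so that it
  applies to u and to -u without computing the weak derivative of -u.\<close>

lemma upper_bound_of_mean_value:
  fixes u p g :: "real \<Rightarrow> real"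
  assumes "a < b" "0 < C" and cont: "continuous_on {a..b} u" "continuous_on {a..b} p" "continuous_on {a..b} g"
    and p: "\<And>t. t \<in> {a..b} \<Longrightarrow> p t > 0"
    and k: "\<And>t. 0 \<le> k t" "\<And>t. k t \<le> 1"
    and mv: "\<And>t. t \<in> {a<..b} \<Longrightarrow> \<exists>c\<in>{a..t}. C * (k t * (u c - u a) + (u t - u c)) + p t * u t = g t"
    and M: "\<And>t. t \<in> {a..b} \<Longrightarrow> g t \<le> M * p t"
    and t: "t \<in> {a..b}"
  shows "u t \<le> M"
proof -
  obtain m where m: "m \<in> {a..b}" "\<And>t. t \<in> {a..b} \<Longrightarrow> u t \<le> u m"
    using continuous_attains_sup[of "{a..b}" u] cont \<open>a < b\<close> by auto
  have "p m * u m \<le> g m"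
  proof (cases "m = a")
    case False
    then obtain c where c: "c \<in> {a..m}" "C * (k m * (u c - u a) + (u m - u c)) + p m * u m = g m"
      using mv[of m] m(1) by auto
    \<comment> \<open>The bracket in the mean value relation, regrouped as a combination of two
      differences that are nonnegative at a maximum.\<close>
    have "0 \<le> k m * (u m - u a) + (1 - k m) * (u m - u c)"
      using k[of m] m(2)[of a] m(2)[of c] c(1) m(1) \<open>a < b\<close>
      by (intro add_nonneg_nonneg mult_nonneg_nonneg) auto
    then have "0 \<le> C * (k m * (u c - u a) + (u m - u c))"
      using \<open>0 < C\<close> by (intro mult_nonneg_nonneg) (auto simp: algebra_simps)
    then show ?thesis using c(2) by linarith
  next
    case True
    have le: "p t * u t \<le> g t + C * (u a - u t)" if t: "t \<in> {a<..b}" for t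
    proof -
      obtain c where c: "c \<in> {a..t}" "C * (k t * (u c - u a) + (u t - u c)) + p t * u t = g t"
        using mv[OF t] by auto
      have "0 \<le> (1 - k t) * (u a - u c)"
        using k[of t] m(2)[of c] c(1) t True by (intro mult_nonneg_nonneg) auto
      then have "u t - u a \<le> k t * (u c - u a) + (u t - u c)"
        by (simp add: algebra_simps)
      then have "C * (u t - u a) \<le> C * (k t * (u c - u a) + (u t - u c))"
        using \<open>0 < C\<close> by (intro mult_left_mono) auto
      then show ?thesis using c(2) by (simp add: algebra_simps)
    qed
    have at_a: "(f \<longlongrightarrow> f a) (at_right a)" if "continuous_on {a..b} f" for f :: "real \<Rightarrow> real"
      using that \<open>a < b\<close> by (rule continuous_on_Icc_at_rightD)
    have "((\<lambda>t. p t * u t) \<longlongrightarrow> p a * u a) (at_right a)"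
      "((\<lambda>t. g t + C * (u a - u t)) \<longlongrightarrow> g a + C * (u a - u a)) (at_right a)"
      by (intro tendsto_intros at_a cont)+
    moreover have "eventually (\<lambda>t. p t * u t \<le> g t + C * (u a - u t)) (at_right a)"
      using eventually_at_right_real[OF \<open>a < b\<close>] by eventually_elim (auto intro: le)
    ultimately have "p a * u a \<le> g a + C * (u a - u a)"
      by (intro tendsto_le[OF trivial_limit_at_right_real])
    then show ?thesis using True by simp
  qed
  also have "\<dots> \<le> p m * M"
    using M[OF m(1)] by (simp add: mult.commute)
  finally have "u m \<le> M"
    using p[OF m(1)] by simp
  then show ?thesis using m(2)[OF t] by simp
qed

theorem lemma3p2:
  fixes a b \<alpha> :: real and B p g u :: "real \<Rightarrow> real"
  assumes "a < b" and "0 < \<alpha>" and "\<alpha> < 1"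
    and "\<And>x. x \<in> {0..1} \<Longrightarrow> B x > 0" and "B 0 = 1" and "B 1 = 1"
    and "continuous_on {a..b} p" and "continuous_on {a..b} g"
    and "\<And>t. t \<in> {a..b} \<Longrightarrow> p t > 0"
    and "u \<in> sobolev_H1 a b"
    and "\<And>t. t \<in> {a<..b} \<Longrightarrow> abc_deriv B \<alpha> a b u t + p t * u t = g t"
  shows "max_on {a..b} (\<lambda>t. \<bar>u t\<bar>) \<le> max_on {a..b} (\<lambda>t. \<bar>g t / p t\<bar>)"
proof -
  let ?M = "max_on {a..b} (\<lambda>t. \<bar>g t / p t\<bar>)"
  define C where "C = B \<alpha> / (1 - \<alpha>)"
  define k where "k t = mittag_leffler \<alpha> (- (\<alpha> / (1 - \<alpha>)) * (t - a) powr \<alpha>)" for t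
  have C: "C > 0"
    using assms(2-4) by (simp add: C_def)
  have u: "continuous_on {a..b} u"
    using assms(10) by (simp add: sobolev_H1_def)
  have arg: "- (\<alpha> / (1 - \<alpha>)) * (t - a) powr \<alpha> \<le> 0" for t
    using assms(2,3) by (intro mult_nonpos_nonneg) auto
  have k: "0 \<le> k t" "k t \<le> 1" for t
    using mittag_leffler_nonneg[OF assms(2) _ arg] mittag_leffler_mono[OF assms(2) _ arg order_refl] assms(3)
    by (auto simp: k_def)
  have mv: "\<exists>c\<in>{a..t}. C * (k t * (u c - u a) + (u t - u c)) + p t * u t = g t" if t: "t \<in> {a<..b}" for t
  proof -
    obtain c where "c \<in> {a..t}" "abc_deriv B \<alpha> a b u t = C * (k t * (u c - u a) + (u t - u c))"
      using abc_deriv_second_mean_value[OF assms(2,3,1,10), of t B] t unfolding C_def k_def by auto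
    then show ?thesis using assms(11)[OF t] by auto
  qed
  have "continuous_on {a..b} (\<lambda>t. \<bar>g t / p t\<bar>)"
    using assms(7-9) by (intro continuous_intros) force+
  then have le: "\<bar>g t / p t\<bar> \<le> ?M" if "t \<in> {a..b}" for t
    using max_on_attained(2)[of "{a..b}" "\<lambda>t. \<bar>g t / p t\<bar>" t] that \<open>a < b\<close> by auto
  have M: "\<bar>g t\<bar> \<le> ?M * p t" if "t \<in> {a..b}" for t
  proof -
    have "\<bar>g t\<bar> = \<bar>g t / p t\<bar> * p t"
      using assms(9)[OF that] by (simp add: abs_divide)
    also have "\<dots> \<le> ?M * p t"
      using le[OF that] assms(9)[OF that] by (intro mult_right_mono) auto
    finally show ?thesis .
  qed
  have "\<bar>u t\<bar> \<le> ?M" if t: "t \<in> {a..b}" for t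
  proof -
    have "u t \<le> ?M"
      by (rule upper_bound_of_mean_value[OF \<open>a < b\<close> C u assms(7-9) k mv _ t])
         (use M in \<open>auto simp: abs_le_iff\<close>)
    moreover have "- u t \<le> ?M"
    \<comment> \<open>The relation is linear in u and g jointly, so negating both keeps the same
      c.\<close>
    proof (rule upper_bound_of_mean_value[OF \<open>a < b\<close> C _ assms(7) _ assms(9) k _ _ t, where u = "\<lambda>t. - u t" and g = "\<lambda>t. - g t"])
      show "\<exists>c\<in>{a..t}. C * (k t * (- u c - - u a) + (- u t - - u c)) + p t * - u t = - g t"
        if t: "t \<in> {a<..b}" for t
      proof -
        obtain c where c: "c \<in> {a..t}" "C * (k t * (u c - u a) + (u t - u c)) + p t * u t = g t"
          using mv[OF t] by blast
        show ?thesis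
          by (rule bexI[OF _ c(1)]) (simp add: c(2)[symmetric] algebra_simps)
      qed
    qed (use u assms(8) M in \<open>auto intro!: continuous_intros simp: abs_le_iff\<close>)
    ultimately show ?thesis by simp
  qed
  moreover have "max_on {a..b} (\<lambda>t. \<bar>u t\<bar>) \<in> (\<lambda>t. \<bar>u t\<bar>) ` {a..b}"
    using u \<open>a < b\<close> by (intro max_on_attained continuous_intros) auto
  ultimately show ?thesis by auto
qed

end
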